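(* Let $(G,+)$ be a finite abelian group and let ${\bf F}$ be a field of characteristic zero or of characteristic $p$ not dividing $|G|$. Let ${\bf E}$ be an extension of ${\bf F}$ containing a primitive $N$-th root of unity, where $N={\rm exp}(G)$, and let $\hat G$ be the group of ${\bf E}$-valued characters of $G$. Then for any subgroup ${\cal K}$ of $\hat G$ and any function $f:G\to{\bf F}$ whose Fourier transform $\hat f$ is not identically zero on ${\cal K}$, \[ |{\rm supp}(f)|\,|{\rm supp}(\hat f)\cap{\cal K}|\ \ge\ |{\cal K}|, \] and equality holds only if ${\rm supp}(\hat f)\cap{\cal K}$ is a coset of a subgroup of ${\cal K}$. In particular, if $f:G\to{\bf F}$ is nonzero, then $|{\rm supp}(f)|\,|{\rm supp}(\hat f)|\ge|G|$, with equality if and only if $f=\lambda\,\chi\, I_{a+H}$ for some $\lambda\in{\bf E}\setminus\{0\}$, some $\chi\in\hat G$, some $a\in G$ and some subgroup $H$ of $G$, where $I_{a+H}$ is the indicator function of the coset $a+H$.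
   Context: Characters are group homomorphisms $G\to{\bf E}^*$; $\hat G$ is the group of characters under pointwise multiplication, written additively. The Fourier transform is $\hat f(\chi)=\sum_{x\in G}f(x)\chi(-x)$. ${\rm supp}(f)=\{x\in G:f(x)\ne0\}$, ${\rm supp}(\hat f)=\{\chi\in\hat G:\hat f(\chi)\ne0\}$. The product $\lambda\chi I_{a+H}$ is the pointwise product of functions on $G$. *)

theory Defs
  imports
    "HOL-Algebra.Algebraic_Closure_Type"
    "HOL-Algebra.Coset"
    "HOL-Library.Indicator_Function"
begin

text \<open>
  A finite abelian group is a \<^locale>\<open>comm_group\<close> with finite carrier, so the group written
  additively on paper is in HOL-Algebra's multiplicative notation here. Fields are types of class
  \<^class>\<open>field\<close>, with \<^const>\<open>ring_of_type_algebra\<close> as the bridge to HOL-Algebra. Functions on the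
  group are total HOL functions whose values outside the carrier are irrelevant.
\<close>

definition group_exponent :: "('g, 'm) monoid_scheme \<Rightarrow> nat" where
  "group_exponent G = (LEAST n. 0 < n \<and> (\<forall>x\<in>carrier G. x [^]\<^bsub>G\<^esub> n = \<one>\<^bsub>G\<^esub>))"

definition primitive_root_of_unity :: "nat \<Rightarrow> 'e::field \<Rightarrow> bool" where
  "primitive_root_of_unity n z \<longleftrightarrow> 0 < n \<and> z ^ n = 1 \<and> (\<forall>k. 0 < k \<and> k < n \<longrightarrow> z ^ k \<noteq> 1)"

text \<open>
  Characters are made extensional (equal to \<^const>\<open>undefined\<close> off the carrier), so that two
  characters agreeing on the carrier are equal and cardinalities of sets of characters are right.
\<close>

definition char_group :: "('g, 'm) monoid_scheme \<Rightarrow> ('g \<Rightarrow> 'e::field) monoid" where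
  "char_group G =
    \<lparr> carrier = hom G (units_of (ring_of_type_algebra :: 'e ring)) \<inter> extensional (carrier G),
      monoid.mult = (\<lambda>\<chi> \<psi>. \<lambda>x\<in>carrier G. \<chi> x * \<psi> x),
      one = (\<lambda>x\<in>carrier G. 1) \<rparr>"

definition fourier :: "('g, 'm) monoid_scheme \<Rightarrow> ('g \<Rightarrow> 'e::field) \<Rightarrow> ('g \<Rightarrow> 'e) \<Rightarrow> 'e" where
  "fourier G f \<chi> = (\<Sum>x\<in>carrier G. f x * \<chi> (inv\<^bsub>G\<^esub> x))"

definition supp_on :: "('x, 'm) monoid_scheme \<Rightarrow> ('x \<Rightarrow> 'b::zero) \<Rightarrow> 'x set" where
  "supp_on M f = {x \<in> carrier M. f x \<noteq> 0}"

lemma units_of_ring_of_type_algebra: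
  "units_of (ring_of_type_algebra :: 'e::field ring) = \<lparr>carrier = - {0}, monoid.mult = (*), one = 1\<rparr>"
proof -
  have "\<exists>y. y * x = 1 \<and> x * y = 1" if "x \<noteq> 0" for x :: 'e
    by (rule exI[of _ "inverse x"]) (use that in simp)
  then show ?thesis
    by (auto simp: units_of_def Units_def ring_of_type_algebra_def)
qed

lemma mem_char_group_iff:
  "\<chi> \<in> carrier (char_group G :: ('g \<Rightarrow> 'e::field) monoid) \<longleftrightarrow>
     \<chi> \<in> extensional (carrier G) \<and> (\<forall>x\<in>carrier G. \<chi> x \<noteq> 0) \<and>
     (\<forall>x\<in>carrier G. \<forall>y\<in>carrier G. \<chi> (x \<otimes>\<^bsub>G\<^esub> y) = \<chi> x * \<chi> y)"
  by (auto simp: char_group_def hom_def units_of_ring_of_type_algebra)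

lemma comm_group_char_group:
  assumes "group G"
  shows "comm_group (char_group G :: ('g \<Rightarrow> 'e::field) monoid)"
proof -
  interpret group G by fact
  show ?thesis
  proof (rule comm_groupI)
    fix \<chi> :: "'g \<Rightarrow> 'e"
    assume \<chi>: "\<chi> \<in> carrier (char_group G)"
    let ?\<psi> = "\<lambda>x\<in>carrier G. inverse (\<chi> x)"
    have "?\<psi> \<in> carrier (char_group G)"
      using \<chi> by (auto simp: mem_char_group_iff)
    moreover have "?\<psi> \<otimes>\<^bsub>char_group G\<^esub> \<chi> = \<one>\<^bsub>char_group G\<^esub>"
      using \<chi> by (auto simp: mem_char_group_iff) (auto simp: char_group_def fun_eq_iff)
    ultimately show "\<exists>\<psi>\<in>carrier (char_group G). \<psi> \<otimes>\<^bsub>char_group G\<^esub> \<chi> = \<one>\<^bsub>char_group G\<^esub>"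
      by blast
  next
    fix \<chi> :: "'g \<Rightarrow> 'e"
    assume "\<chi> \<in> carrier (char_group G)"
    then show "\<one>\<^bsub>char_group G\<^esub> \<otimes>\<^bsub>char_group G\<^esub> \<chi> = \<chi>"
      by (auto simp: mem_char_group_iff) (auto simp: char_group_def fun_eq_iff extensional_def)
  qed (unfold mem_char_group_iff, auto simp: char_group_def fun_eq_iff mult_ac)
qed

end

theory Submission
  imports Defs
begin

text \<open>
  If \<open>F\<close> is a combination of \<open>s\<close> multiplicative functions on a finite abelian group \<open>X\<close>, then any
  linearly independent family of translates of \<open>F\<close> has at most \<open>s\<close> members. A translate whose
  support is not covered by the supports of the previous ones is independent of them, so a greedy
  choice yields an independent family of translates whose supports cover \<open>X\<close>, whence
  \<open>|X| \<le> s |supp F|\<close>. If equality holds, the greedy choice can never be improved: two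
  overlapping translates are proportional. Hence \<open>supp F\<close> is a coset of the subgroup of those
  \<open>h\<close> for which translation by \<open>h\<close> multiplies \<open>F\<close> by a constant.

  The first claim is the case where \<open>X\<close> is \<open>K\<close> and \<open>F\<close> is the Fourier transform of \<open>f\<close>. The
  equality case of the second one is obtained by taking \<open>X\<close> to be \<open>G\<close> and \<open>F\<close> to be \<open>f\<close>, a
  combination of the characters in the support of its transform by Fourier inversion; each of these
  characters agrees on \<open>H\<close> with the multiplier of \<open>f\<close>.
\<close>

section \<open>Homogeneous linear systems\<close>

text \<open>Gaussian elimination, by induction on the set \<open>S\<close> of equations in the
  unknowns \<open>c a\<close>. The dimension counts below are reduced to this.\<close>

lemma underdetermined_system_has_nontrivial_solution:
  fixes u :: "'a \<Rightarrow> 's \<Rightarrow> 'e::field"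
  assumes "finite S" "finite A" "card S < card A"
  shows "\<exists>c. (\<exists>a\<in>A. c a \<noteq> 0) \<and> (\<forall>s\<in>S. (\<Sum>a\<in>A. c a * u a s) = 0)"
  using assms
proof (induction S arbitrary: A u rule: finite_induct)
  case empty
  then have "A \<noteq> {}" by auto
  then show ?case by (intro exI[of _ "\<lambda>_. 1"]) auto
next
  case (insert s S)
  show ?case
  proof (cases "\<forall>a\<in>A. u a s = 0")
    case True
    have "card S < card A" using insert by simp
    from insert.IH[OF \<open>finite A\<close> this, of u] obtain c
      where "\<exists>a\<in>A. c a \<noteq> 0" "\<forall>s\<in>S. (\<Sum>a\<in>A. c a * u a s) = 0" by blast
    then show ?thesis using True by (intro exI[of _ c]) auto
  next
    case False
    then obtain b where b: "b \<in> A" "u b s \<noteq> 0" by blast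
    define B where "B = A - {b}"
    have A: "A = insert b B" "b \<notin> B" "finite B" using b insert.prems by (auto simp: B_def)
    have "card S < card B" using insert A by simp
    \<comment> \<open>These are the coefficients left in the equation \<open>t\<close> once the
      unknown at \<open>b\<close> has been eliminated by means of the equation
      \<open>s\<close>.\<close>
    from insert.IH[OF \<open>finite B\<close> this, of "\<lambda>a t. u a t - u a s / u b s * u b t"] obtain c
      where c: "\<exists>a\<in>B. c a \<noteq> 0" "\<And>t. t \<in> S \<Longrightarrow> (\<Sum>a\<in>B. c a * (u a t - u a s / u b s * u b t)) = 0"
      by blast
    \<comment> \<open>The value at \<open>b\<close> is the one that makes the equation
      \<open>s\<close> hold.\<close>
    define d where "d = c(b := - (\<Sum>a\<in>B. c a * u a s) / u b s)"
    have sum_d: "(\<Sum>a\<in>A. d a * u a t) = d b * u b t + (\<Sum>a\<in>B. c a * u a t)" for t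
    proof -
      have "(\<Sum>a\<in>B. d a * u a t) = (\<Sum>a\<in>B. c a * u a t)"
        by (rule sum.cong) (use A in \<open>auto simp: d_def\<close>)
      then show ?thesis using A by simp
    qed
    have "(\<Sum>a\<in>A. d a * u a t) = 0" if "t \<in> S" for t
    proof -
      have "(\<Sum>a\<in>B. c a * (u a t - u a s / u b s * u b t))
          = (\<Sum>a\<in>B. c a * u a t) - (\<Sum>a\<in>B. c a * u a s) / u b s * u b t"
        by (simp add: right_diff_distrib sum_subtractf sum_divide_distrib sum_distrib_right mult.assoc)
      moreover have "d b = - ((\<Sum>a\<in>B. c a * u a s) / u b s)" by (simp add: d_def)
      ultimately show ?thesis using c(2)[OF that] by (simp only: sum_d) simp
    qed
    moreover have "(\<Sum>a\<in>A. d a * u a s) = 0"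
      using b by (simp only: sum_d) (simp add: d_def)
    moreover have "\<exists>a\<in>A. d a \<noteq> 0"
      using c(1) A by (auto simp: d_def)
    ultimately show ?thesis by (intro exI[of _ d]) auto
  qed
qed

lemma supp_on_subgroup:
  "subgroup K M \<Longrightarrow> supp_on (M\<lparr>carrier := K\<rparr>) F = supp_on M F \<inter> K"
  using subgroup.subset by (auto simp: supp_on_def)

section \<open>Translates of a combination of multiplicative functions\<close>

text \<open>The index type of \<open>S\<close> is kept free because the locale is used twice: with
  group elements indexing functions on a group of characters, and with characters indexing functions
  on \<open>G\<close>.\<close>

locale multiplicative_combination = comm_group M for M :: "('a, 'b) monoid_scheme" (structure) +
  fixes S :: "'s set" and c :: "'s \<Rightarrow> 'e::field" and e :: "'s \<Rightarrow> 'a \<Rightarrow> 'e" and F :: "'a \<Rightarrow> 'e"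
  assumes finite_carrier: "finite (carrier M)" and finite_S: "finite S"
    and e_mult: "\<lbrakk>s \<in> S; x \<in> carrier M; y \<in> carrier M\<rbrakk> \<Longrightarrow> e s (x \<otimes> y) = e s x * e s y"
    and F_eq: "x \<in> carrier M \<Longrightarrow> F x = (\<Sum>s\<in>S. c s * e s x)"
    and F_nonzero: "\<exists>x\<in>carrier M. F x \<noteq> 0"
begin

definition translate_supp :: "'a \<Rightarrow> 'a set" where
  "translate_supp a = {z \<in> carrier M. F (a \<otimes> z) \<noteq> 0}"

text \<open>Independence is that of a family indexed by \<open>A\<close>, not of a set of functions:
  two elements of \<open>A\<close> giving the same translate count as dependent, so
  \<open>card A\<close> is the size of the family.\<close>

definition indep_translates :: "'a set \<Rightarrow> bool" where
  "indep_translates A \<longleftrightarrow> A \<subseteq> carrier M \<and>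
     (\<forall>k. (\<forall>z\<in>carrier M. (\<Sum>a\<in>A. k a * F (a \<otimes> z)) = 0) \<longrightarrow> (\<forall>a\<in>A. k a = 0))"

lemma indep_translates_finite: "indep_translates A \<Longrightarrow> finite A"
  using finite_carrier finite_subset by (auto simp: indep_translates_def)

text \<open>In the translate by \<open>a\<close> the function \<open>e s\<close> has coefficient
  \<open>c s * e s a\<close>. Coefficients \<open>k\<close> orthogonal to every \<open>e s\<close>
  on \<open>A\<close> therefore annihilate the translates, and a nonzero such \<open>k\<close>
  exists once \<open>A\<close> has more elements than \<open>S\<close>.\<close>

lemma card_indep_translates_le:
  assumes "indep_translates A"
  shows "card A \<le> card S"
proof (rule ccontr)
  assume "\<not> ?thesis"
  then obtain k where k: "\<exists>a\<in>A. k a \<noteq> 0" "\<And>s. s \<in> S \<Longrightarrow> (\<Sum>a\<in>A. k a * e s a) = 0"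
    using underdetermined_system_has_nontrivial_solution
      [OF finite_S indep_translates_finite[OF assms], of "\<lambda>a s. e s a"] by auto
  have AX: "A \<subseteq> carrier M" using assms by (simp add: indep_translates_def)
  have "(\<Sum>a\<in>A. k a * F (a \<otimes> z)) = 0" if z: "z \<in> carrier M" for z
  proof -
    have "(\<Sum>a\<in>A. k a * F (a \<otimes> z)) = (\<Sum>a\<in>A. \<Sum>s\<in>S. c s * e s z * (k a * e s a))"
    proof (rule sum.cong[OF refl])
      fix a assume "a \<in> A"
      then have a: "a \<in> carrier M" using AX by auto
      have "(\<Sum>s\<in>S. c s * e s (a \<otimes> z)) = (\<Sum>s\<in>S. c s * (e s a * e s z))"
        by (rule sum.cong) (auto simp: e_mult a z)
      then show "k a * F (a \<otimes> z) = (\<Sum>s\<in>S. c s * e s z * (k a * e s a))"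
        using a z by (simp add: F_eq sum_distrib_left mult_ac)
    qed
    also have "\<dots> = (\<Sum>s\<in>S. c s * e s z * (\<Sum>a\<in>A. k a * e s a))"
      by (subst sum.swap) (simp add: sum_distrib_left)
    also have "\<dots> = 0" by (simp add: k(2))
    finally show ?thesis .
  qed
  then show False using assms k(1) by (auto simp: indep_translates_def)
qed

lemma card_translate_supp:
  assumes a: "a \<in> carrier M"
  shows "card (translate_supp a) = card (supp_on M F)"
proof -
  have "bij_betw (\<lambda>z. a \<otimes> z) (translate_supp a) (supp_on M F)"
  proof (rule bij_betw_byWitness[where f' = "\<lambda>z. inv a \<otimes> z"])
  qed (use a in \<open>auto simp: translate_supp_def supp_on_def m_assoc[symmetric]\<close>)
  then show ?thesis by (rule bij_betw_same_card)
qed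

text \<open>Evaluated at \<open>z\<close>, a linear relation keeps only the term of the new
  translate, so its coefficient vanishes and a relation among the old ones remains.\<close>

lemma indep_translates_insert:
  assumes A: "indep_translates A" and z: "z \<in> carrier M" "z \<notin> (\<Union>a\<in>A. translate_supp a)"
  shows "\<exists>a. a \<notin> A \<and> indep_translates (insert a A)"
proof -
  obtain t where t: "t \<in> carrier M" "F t \<noteq> 0" using F_nonzero by blast
  \<comment> \<open>With this choice \<open>b \<otimes> z\<close> is the point \<open>t\<close>,
    where \<open>F\<close> is nonzero.\<close>
  define b where "b = t \<otimes> inv z"
  have b: "b \<in> carrier M" "F (b \<otimes> z) \<noteq> 0" using t z by (simp_all add: b_def m_assoc)
  have 0: "F (a \<otimes> z) = 0" if "a \<in> A" for a using that z by (auto simp: translate_supp_def)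
  then have "b \<notin> A" using b by blast
  have fin: "finite A" using A by (rule indep_translates_finite)
  have "\<forall>a\<in>insert b A. k a = 0"
    if k: "\<forall>z\<in>carrier M. (\<Sum>a\<in>insert b A. k a * F (a \<otimes> z)) = 0" for k
  proof -
    have "(\<Sum>a\<in>insert b A. k a * F (a \<otimes> z)) = k b * F (b \<otimes> z)"
      using fin \<open>b \<notin> A\<close> 0 by simp
    then have kb: "k b = 0" using k z b by simp
    then have "\<forall>z\<in>carrier M. (\<Sum>a\<in>A. k a * F (a \<otimes> z)) = 0"
      using k fin \<open>b \<notin> A\<close> by simp
    then show ?thesis using A kb by (auto simp: indep_translates_def)
  qed
  then have "indep_translates (insert b A)"
    using A b by (auto simp: indep_translates_def)
  then show ?thesis using \<open>b \<notin> A\<close> by blast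
qed

text \<open>A largest independent \<open>B\<close> containing \<open>A\<close> has supports covering
  the group, since otherwise it could be enlarged. Each member outside \<open>A\<close> adds at most
  \<open>card (supp_on M F)\<close> points, and \<open>B\<close> has at most \<open>card S\<close>
  members. Keeping \<open>A\<close> arbitrary serves both uses: the empty set gives the inequality,
  a pair gives the equality case.\<close>

lemma card_le_of_indep_translates:
  assumes A: "indep_translates A"
  shows "card (carrier M) + card A * card (supp_on M F)
       \<le> card (\<Union>a\<in>A. translate_supp a) + card S * card (supp_on M F)"
proof -
  let ?\<F> = "{B. A \<subseteq> B \<and> indep_translates B}"
  let ?m = "Max (card ` ?\<F>)"
  have fin: "finite ?\<F>"
    by (rule finite_subset[of _ "Pow (carrier M)"]) (auto simp: indep_translates_def finite_carrier)
  moreover have "A \<in> ?\<F>" using A by simp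
  ultimately have "?m \<in> card ` ?\<F>" by (intro Max_in) auto
  then obtain B where B: "A \<subseteq> B" "indep_translates B" "card B = ?m" by auto
  have "(\<Union>a\<in>B. translate_supp a) = carrier M"
  proof (rule ccontr)
    assume "\<not> ?thesis"
    then obtain z where "z \<in> carrier M" "z \<notin> (\<Union>a\<in>B. translate_supp a)"
      by (auto simp: translate_supp_def)
    then obtain b where b: "b \<notin> B" "indep_translates (insert b B)"
      using indep_translates_insert B by blast
    then have "card (insert b B) \<le> ?m" using B fin by (intro Max_ge) auto
    then show False using b B indep_translates_finite by simp
  qed
  moreover have "B = A \<union> (B - A)" using B by blast
  ultimately have "carrier M = (\<Union>a\<in>A. translate_supp a) \<union> (\<Union>a\<in>B - A. translate_supp a)"
    by blast
  then have "card (carrier M)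
      \<le> card (\<Union>a\<in>A. translate_supp a) + card (\<Union>a\<in>B - A. translate_supp a)"
    by (metis card_Un_le)
  also have "card (\<Union>a\<in>B - A. translate_supp a) \<le> (\<Sum>a\<in>B - A. card (translate_supp a))"
    using B indep_translates_finite by (intro card_UN_le) auto
  also have "\<dots> = card (B - A) * card (supp_on M F)"
    using B by (subst sum.cong[OF refl card_translate_supp]) (auto simp: indep_translates_def)
  also have "card (B - A) = card B - card A"
    using B A indep_translates_finite by (intro card_Diff_subset) auto
  finally have "card (carrier M) + card A * card (supp_on M F)
      \<le> card (\<Union>a\<in>A. translate_supp a) + (card B - card A + card A) * card (supp_on M F)"
    by (simp add: add_mult_distrib)
  also have "card B - card A + card A = card B"
    using B indep_translates_finite card_mono by fastforce
  also have "card B * card (supp_on M F) \<le> card S * card (supp_on M F)"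
    using card_indep_translates_le[OF B(2)] by (rule mult_right_mono) simp
  finally show ?thesis by simp
qed

lemma card_carrier_le: "card (carrier M) \<le> card S * card (supp_on M F)"
  using card_le_of_indep_translates[of "{}"] by (simp add: indep_translates_def)

section \<open>The equality case and the stabiliser of the line spanned by \<open>F\<close>\<close>

definition multiplier_group :: "'a set" where
  "multiplier_group = {a \<in> carrier M. \<exists>\<mu>. \<mu> \<noteq> 0 \<and> (\<forall>z\<in>carrier M. F (a \<otimes> z) = \<mu> * F z)}"

lemma subgroup_multiplier_group: "subgroup multiplier_group M"
proof (rule subgroupI)
  show "multiplier_group \<subseteq> carrier M" by (auto simp: multiplier_group_def)
  have "\<one> \<in> multiplier_group" by (auto simp: multiplier_group_def intro!: exI[of _ 1])
  then show "multiplier_group \<noteq> {}" by blast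
next
  fix a assume "a \<in> multiplier_group"
  then obtain \<mu> where a: "a \<in> carrier M" "\<mu> \<noteq> 0" "\<And>z. z \<in> carrier M \<Longrightarrow> F (a \<otimes> z) = \<mu> * F z"
    by (auto simp: multiplier_group_def)
  have "F (inv a \<otimes> z) = inverse \<mu> * F z" if "z \<in> carrier M" for z
    using a(3)[of "inv a \<otimes> z"] a(1,2) that by (simp add: m_assoc[symmetric] field_simps)
  then show "inv a \<in> multiplier_group"
    using a by (auto simp: multiplier_group_def intro!: exI[of _ "inverse \<mu>"])
next
  fix a b assume "a \<in> multiplier_group" "b \<in> multiplier_group"
  then obtain \<mu> \<nu> where a: "a \<in> carrier M" "\<mu> \<noteq> 0" "\<And>z. z \<in> carrier M \<Longrightarrow> F (a \<otimes> z) = \<mu> * F z"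
    and b: "b \<in> carrier M" "\<nu> \<noteq> 0" "\<And>z. z \<in> carrier M \<Longrightarrow> F (b \<otimes> z) = \<nu> * F z"
    by (auto simp: multiplier_group_def)
  have "F (a \<otimes> b \<otimes> z) = (\<mu> * \<nu>) * F z" if "z \<in> carrier M" for z
    using a b that by (simp add: m_assoc)
  then show "a \<otimes> b \<in> multiplier_group"
    using a b by (auto simp: multiplier_group_def intro!: exI[of _ "\<mu> * \<nu>"])
qed

text \<open>Were \<open>F\<close> and its translate independent, the bound for the pair
  \<open>{\<one>, a}\<close> together with \<open>eq\<close> would make the union of their supports
  as large as the sum of their sizes, hence the supports disjoint. But both contain
  \<open>z\<close>.\<close>

lemma overlapping_translate_proportional:
  assumes eq: "card S * card (supp_on M F) = card (carrier M)"
    and a: "a \<in> carrier M" and z: "z \<in> carrier M" "F z \<noteq> 0" "F (a \<otimes> z) \<noteq> 0"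
  shows "a \<in> multiplier_group"
proof (cases "a = \<one>")
  case True
  then show ?thesis using subgroup.one_closed[OF subgroup_multiplier_group] by simp
next
  case False
  have fin: "finite (translate_supp b)" for b
    using finite_carrier by (auto simp: translate_supp_def)
  have z': "z \<in> translate_supp a" "z \<in> translate_supp \<one>" using a z by (auto simp: translate_supp_def)
  have "\<not> indep_translates {\<one>, a}"
  proof
    assume "indep_translates {\<one>, a}"
    from card_le_of_indep_translates[OF this] False eq
    have "2 * card (supp_on M F) \<le> card (translate_supp \<one> \<union> translate_supp a)"
      by simp
    moreover have "card (translate_supp \<one>) + card (translate_supp a)
        = card (translate_supp \<one> \<union> translate_supp a) + card (translate_supp \<one> \<inter> translate_supp a)"
      using fin by (rule card_Un_Int) (rule fin)
    moreover have "card (translate_supp \<one> \<inter> translate_supp a) > 0"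
      using z' fin by (auto simp: card_gt_0_iff)
    ultimately show False using a by (simp add: card_translate_supp)
  qed
  then obtain k where k: "\<And>z. z \<in> carrier M \<Longrightarrow> k \<one> * F z + k a * F (a \<otimes> z) = 0"
    and nz: "k \<one> \<noteq> 0 \<or> k a \<noteq> 0"
    using a False by (auto simp: indep_translates_def)
  \<comment> \<open>At \<open>z\<close> both values of \<open>F\<close> are nonzero, so neither
    coefficient can vanish without the other.\<close>
  have nz': "k \<one> \<noteq> 0" "k a \<noteq> 0" using k[OF z(1)] z nz by auto
  have "F (a \<otimes> w) = (- k \<one> / k a) * F w" if "w \<in> carrier M" for w
    using k[OF that] nz' by (simp add: field_simps eq_neg_iff_add_eq_0)
  then show ?thesis using a nz' by (auto simp: multiplier_group_def intro!: exI[of _ "- k \<one> / k a"])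
qed

text \<open>For \<open>x\<close> and \<open>t\<close> in the support, translation by
  \<open>x \<otimes> inv t\<close> takes \<open>t\<close> to \<open>x\<close>, so the translate
  overlaps with \<open>F\<close> at \<open>t\<close>. Conversely a multiplier preserves the
  support.\<close>

lemma supp_eq_coset:
  assumes eq: "card S * card (supp_on M F) = card (carrier M)" and t: "t \<in> supp_on M F"
  shows "supp_on M F = t <# multiplier_group"
proof
  have t': "t \<in> carrier M" "F t \<noteq> 0" using t by (auto simp: supp_on_def)
  show "supp_on M F \<subseteq> t <# multiplier_group"
  proof
    fix x assume "x \<in> supp_on M F"
    then have x: "x \<in> carrier M" "F x \<noteq> 0" by (auto simp: supp_on_def)
    have "x \<otimes> inv t \<in> multiplier_group"
      by (rule overlapping_translate_proportional[OF eq _ t']) (use x t' in \<open>auto simp: m_assoc\<close>)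
    moreover have "x = t \<otimes> (x \<otimes> inv t)" using x t' m_lcomm[of t x "inv t"] by simp
    ultimately show "x \<in> t <# multiplier_group" by (auto simp: l_coset_def)
  qed
  show "t <# multiplier_group \<subseteq> supp_on M F"
    using t' by (auto simp: l_coset_def multiplier_group_def supp_on_def m_comm[of t])
qed

end

section \<open>Roots of unity and extension of characters\<close>

lemma finite_card_roots_of_unity:
  assumes "0 < m"
  shows "finite {z :: 'e::field. z ^ m = 1}" "card {z :: 'e::field. z ^ m = 1} \<le> m"
proof -
  let ?p = "monom 1 m - 1 :: 'e poly"
  have "coeff ?p m = 1" using assms by (simp add: coeff_1)
  then have "?p \<noteq> 0" by (metis coeff_0 zero_neq_one)
  moreover have "degree ?p \<le> m"
    by (rule degree_diff_le) (auto simp: degree_monom_le)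
  moreover have "{z. z ^ m = 1} = {z. poly ?p z = 0}" by (simp add: poly_monom)
  ultimately show "finite {z :: 'e. z ^ m = 1}" "card {z :: 'e. z ^ m = 1} \<le> m"
    using poly_roots_finite[of ?p] card_poly_roots_bound[of ?p] by auto
qed

text \<open>The powers of \<open>w\<close> with exponents below \<open>m\<close> are
  \<open>m\<close> distinct roots of a polynomial of degree \<open>m\<close>, so they exhaust its
  roots.\<close>

lemma root_of_unity_is_power:
  fixes z w :: "'e::field"
  assumes w: "primitive_root_of_unity m w" and z: "z ^ m = 1"
  shows "\<exists>k. z = w ^ k"
proof -
  have m: "0 < m" "w ^ m = 1" and least: "\<And>k. 0 < k \<Longrightarrow> k < m \<Longrightarrow> w ^ k \<noteq> 1"
    using w by (auto simp: primitive_root_of_unity_def)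
  have "w \<noteq> 0" using m by (auto simp: power_0_left)
  have "i = j" if "i < m" "j < m" "i \<le> j" "w ^ i = w ^ j" for i j
  proof (rule ccontr)
    assume "i \<noteq> j"
    have "w ^ j = w ^ i * w ^ (j - i)" using \<open>i \<le> j\<close> by (simp flip: power_add)
    then have "w ^ (j - i) = 1" using that \<open>w \<noteq> 0\<close> by simp
    then show False using least[of "j - i"] that \<open>i \<noteq> j\<close> by simp
  qed
  then have "inj_on (\<lambda>k. w ^ k) {..<m}"
    by (metis inj_onI lessThan_iff nat_le_linear)
  then have "card ((\<lambda>k. w ^ k) ` {..<m}) = m" by (simp add: card_image)
  moreover have "(\<lambda>k. w ^ k) ` {..<m} \<subseteq> {z. z ^ m = 1}"
  proof
    fix z assume "z \<in> (\<lambda>k. w ^ k) ` {..<m}"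
    then obtain k where "z = w ^ k" by blast
    then have "z ^ m = (w ^ m) ^ k" by (simp add: mult.commute flip: power_mult)
    then show "z \<in> {z. z ^ m = 1}" using m by simp
  qed
  ultimately have "(\<lambda>k. w ^ k) ` {..<m} = {z. z ^ m = 1}"
    using finite_card_roots_of_unity[OF m(1), where 'e = 'e]
    by (metis card_seteq)
  then show ?thesis using z by auto
qed

lemma primitive_root_of_unity_power:
  assumes "primitive_root_of_unity (n * m) w"
  shows "primitive_root_of_unity m (w ^ n)"
  using assms by (auto simp: primitive_root_of_unity_def power_mult[symmetric])

text \<open>Everything in this locale takes place over the large field; the small one enters through
  the embedding in the final theorem.\<close>

locale fourier_setting = comm_group G for G :: "('g, 'm) monoid_scheme" (structure) +
  fixes \<zeta> :: "'e::field"
  assumes finite_G: "finite (carrier G)"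
    and card_nonzero: "of_nat (card (carrier G)) \<noteq> (0 :: 'e)"
    and primitive: "primitive_root_of_unity (group_exponent G) \<zeta>"
begin

abbreviation Ghat :: "('g \<Rightarrow> 'e) monoid" where "Ghat \<equiv> char_group G"

text \<open>A character of the subgroup \<open>H\<close> as a total function. On a subgroup the
  value 1 at \<open>\<one>\<close> forces all values to be nonzero.\<close>

definition mult_on :: "'g set \<Rightarrow> ('g \<Rightarrow> 'e) \<Rightarrow> bool" where
  "mult_on H \<phi> \<longleftrightarrow> \<phi> \<one> = 1 \<and> (\<forall>x\<in>H. \<forall>y\<in>H. \<phi> (x \<otimes> y) = \<phi> x * \<phi> y)"

lemma pow_exponent: "x \<in> carrier G \<Longrightarrow> x [^] group_exponent G = \<one>"
proof -
  have "0 < Coset.order G" using finite_G by (simp add: order_gt_0_iff_finite)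
  then have "\<exists>n::nat. 0 < n \<and> (\<forall>x\<in>carrier G. x [^] n = \<one>)"
    using pow_order_eq_1 by blast
  from LeastI_ex[OF this] show "x \<in> carrier G \<Longrightarrow> x [^] group_exponent G = \<one>"
    by (simp add: group_exponent_def)
qed

lemma subgroup_nat_pow_closed: "\<lbrakk>subgroup H G; h \<in> H\<rbrakk> \<Longrightarrow> h [^] (n::nat) \<in> H"
  by (induction n) (simp_all add: subgroup.one_closed subgroup.m_closed)

text \<open>The number \<open>n\<close> is the order of \<open>a\<close> modulo \<open>H\<close>.
  The remainder of \<open>m\<close> by \<open>n\<close> is again an exponent with power in
  \<open>H\<close>, so by minimality it is zero.\<close>

lemma least_power_in_subgroup:
  assumes H: "subgroup H G" and a: "a \<in> carrier G"
  obtains n :: nat where "0 < n" "a [^] n \<in> H" "\<And>m::nat. a [^] m \<in> H \<Longrightarrow> n dvd m"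
proof -
  interpret H: subgroup H G by fact
  let ?P = "\<lambda>n::nat. 0 < n \<and> a [^] n \<in> H"
  have "?P (group_exponent G)"
    using primitive pow_exponent[OF a] by (simp add: primitive_root_of_unity_def)
  define n where "n = Least ?P"
  have n: "?P n" unfolding n_def by (rule LeastI) fact
  have least: "n \<le> m" if "?P m" for m unfolding n_def by (rule Least_le) fact
  have "n dvd m" if m: "a [^] m \<in> H" for m :: nat
  proof -
    have q: "(a [^] n) [^] (m div n) \<in> H" using n H by (simp add: subgroup_nat_pow_closed)
    have "a [^] m = (a [^] n) [^] (m div n) \<otimes> a [^] (m mod n)"
      using a by (simp add: nat_pow_pow nat_pow_mult)
    then have "a [^] (m mod n) = inv ((a [^] n) [^] (m div n)) \<otimes> a [^] m"
      using a by (simp add: m_assoc[symmetric])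
    then have "a [^] (m mod n) \<in> H" using q m by simp
    then have "m mod n = 0" using least[of "m mod n"] n by (meson gr0I mod_less_divisor not_le)
    then show ?thesis by auto
  qed
  with n show ?thesis using that by blast
qed

lemma mult_on_pow:
  assumes "subgroup H G" "mult_on H \<phi>" "h \<in> H"
  shows "\<phi> (h [^] (k::nat)) = \<phi> h ^ k"
proof (induction k)
  case 0
  then show ?case using assms by (simp add: mult_on_def)
next
  case (Suc k)
  have "h [^] k \<in> H" using assms by (simp add: subgroup_nat_pow_closed)
  then show ?case using assms Suc by (simp add: mult_on_def)
qed

text \<open>The extension to the subgroup generated by \<open>H\<close> and \<open>a\<close> sends
  \<open>h \<otimes> a [^] i\<close> to \<open>\<phi> h * y ^ i\<close>. Two representations of one
  element have exponents differing by a multiple of \<open>n\<close>, and \<open>y ^ n\<close>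
  agrees with \<open>\<phi> (a [^] n)\<close>. The root \<open>y\<close> stays free because
  separating points requires a particular one.\<close>

lemma mult_on_extend_by_root:
  assumes H: "subgroup H G" and \<phi>: "mult_on H \<phi>" and a: "a \<in> carrier G"
    and n: "a [^] (n::nat) \<in> H" "\<And>m::nat. a [^] m \<in> H \<Longrightarrow> n dvd m" and y: "y ^ n = \<phi> (a [^] n)"
  shows "\<exists>H' \<psi>. subgroup H' G \<and> H \<subseteq> H' \<and> a \<in> H' \<and> mult_on H' \<psi> \<and> (\<forall>h\<in>H. \<psi> h = \<phi> h) \<and> \<psi> a = y"
proof -
  interpret H: subgroup H G by fact
  have \<phi>1: "\<phi> \<one> = 1" and \<phi>m: "\<And>x z. x \<in> H \<Longrightarrow> z \<in> H \<Longrightarrow> \<phi> (x \<otimes> z) = \<phi> x * \<phi> z"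
    using \<phi> by (auto simp: mult_on_def)
  define H' where "H' = {h \<otimes> a [^] (i::nat) | h i. h \<in> H}"
  have wd': "\<phi> h * y ^ i = \<phi> k * y ^ j"
    if h: "h \<in> H" "k \<in> H" "h \<otimes> a [^] i = k \<otimes> a [^] j" "i \<le> j" for h k and i j :: nat
  proof -
    have "a [^] j = a [^] (j - i) \<otimes> a [^] i" using a h by (simp add: nat_pow_mult)
    then have "h \<otimes> a [^] i = (k \<otimes> a [^] (j - i)) \<otimes> a [^] i" using h a by (simp add: m_assoc)
    then have hk: "h = k \<otimes> a [^] (j - i)" using h a by simp
    then have "a [^] (j - i) = inv k \<otimes> h" using h a by (simp add: m_assoc[symmetric])
    then have "a [^] (j - i) \<in> H" using h by simp
    then obtain q where q: "j - i = n * q" using n by (meson dvdE)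
    have "\<phi> h = \<phi> k * \<phi> (a [^] (j - i))" using hk h \<open>a [^] (j - i) \<in> H\<close> \<phi>m by simp
    also have "a [^] (j - i) = (a [^] n) [^] q" using a by (simp add: q nat_pow_pow)
    also have "\<phi> \<dots> = y ^ (j - i)" using mult_on_pow[OF H \<phi> n(1)] y by (simp add: q power_mult)
    finally show ?thesis using h(4) by (simp flip: power_add)
  qed
  then have wd: "\<phi> h * y ^ i = \<phi> k * y ^ j"
    if "h \<in> H" "k \<in> H" "h \<otimes> a [^] i = k \<otimes> a [^] j" for h k and i j :: nat
    using that by (metis nat_le_linear)
  \<comment> \<open>The choice is harmless: by \<open>wd\<close> all representations of
    \<open>x\<close> give the same value.\<close>
  define \<psi> where "\<psi> x = (SOME v. \<exists>h i. h \<in> H \<and> x = h \<otimes> a [^] (i::nat) \<and> v = \<phi> h * y ^ i)" for x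
  have \<psi>: "\<psi> (h \<otimes> a [^] i) = \<phi> h * y ^ i" if "h \<in> H" for h and i :: nat
    unfolding \<psi>_def
  proof (rule some_equality)
    show "\<exists>k j. k \<in> H \<and> h \<otimes> a [^] i = k \<otimes> a [^] (j::nat) \<and> \<phi> h * y ^ i = \<phi> k * y ^ j"
      using that by (intro exI[of _ h] exI[of _ i]) simp
  qed (metis that wd)
  have prod: "(h \<otimes> a [^] i) \<otimes> (k \<otimes> a [^] j) = (h \<otimes> k) \<otimes> a [^] (i + j)"
    if "h \<in> H" "k \<in> H" for h k and i j :: nat
    using that a by (simp add: nat_pow_mult[symmetric] m_ac)
  have sub: "H \<subseteq> H'"
  proof
    fix h assume "h \<in> H"
    then show "h \<in> H'" unfolding H'_def by (auto intro!: exI[of _ h] exI[of _ "0::nat"])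
  qed
  have "subgroup H' G"
  proof (rule subgroupI)
    show "H' \<subseteq> carrier G" using a by (auto simp: H'_def)
    show "H' \<noteq> {}" using sub H.one_closed by blast
    show "x \<otimes> z \<in> H'" if "x \<in> H'" "z \<in> H'" for x z
      using that prod unfolding H'_def by clarsimp (metis H.m_closed)
    show "inv x \<in> H'" if x': "x \<in> H'" for x
    proof -
      obtain h and i :: nat where x: "h \<in> H" "x = h \<otimes> a [^] i" using x' by (auto simp: H'_def)
      \<comment> \<open>The power \<open>a [^] (i * (N - 1))\<close> plays the role of the inverse
        of \<open>a [^] i\<close>, which keeps exponents natural.\<close>
      define N where "N = group_exponent G"
      have "i + i * (N - 1) = N * i"
        using primitive by (simp add: N_def primitive_root_of_unity_def algebra_simps)
      then have "(inv h \<otimes> a [^] (i * (N - 1))) \<otimes> x = a [^] (N * i)"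
        using x a prod[of "inv h" h "i * (N - 1)" i] by (simp add: add.commute)
      also have "\<dots> = \<one>" using a pow_exponent[OF a] by (simp add: N_def flip: nat_pow_pow)
      finally have "inv x = inv h \<otimes> a [^] (i * (N - 1))"
        using x a by (intro inv_equality) auto
      then show ?thesis using x unfolding H'_def by blast
    qed
  qed
  moreover have "a \<in> H'"
    unfolding H'_def using a by (auto intro!: exI[of _ \<one>] exI[of _ "1::nat"])
  moreover have ext: "\<psi> h = \<phi> h" if "h \<in> H" for h
    using \<psi>[OF that, of 0] that by simp
  moreover have "\<psi> a = y" using \<psi>[of \<one> 1] a \<phi>1 by simp
  moreover have "mult_on H' \<psi>"
    unfolding mult_on_def
  proof (intro conjI ballI)
    show "\<psi> \<one> = 1" using ext \<phi>1 by simp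
    fix x z assume "x \<in> H'" "z \<in> H'"
    then obtain h k and i j :: nat
      where "h \<in> H" "k \<in> H" "x = h \<otimes> a [^] i" "z = k \<otimes> a [^] j" by (auto simp: H'_def)
    then show "\<psi> (x \<otimes> z) = \<psi> x * \<psi> z"
      by (simp only: prod \<psi> H.m_closed \<phi>m power_add) (simp add: mult_ac)
  qed
  ultimately show ?thesis using sub by blast
qed

text \<open>An \<open>n\<close>-th root of \<open>\<phi> (a [^] n)\<close> is required. Writing the
  exponent as \<open>n * m\<close>, this value is an \<open>m\<close>-th root of unity, hence a
  power of \<open>\<zeta> ^ n\<close>, hence an \<open>n\<close>-th power.\<close>

lemma mult_on_extend_step:
  assumes H: "subgroup H G" and \<phi>: "mult_on H \<phi>" and a: "a \<in> carrier G"
  shows "\<exists>H' \<psi>. subgroup H' G \<and> H \<subseteq> H' \<and> a \<in> H' \<and> mult_on H' \<psi> \<and> (\<forall>h\<in>H. \<psi> h = \<phi> h)"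
proof -
  obtain n :: nat where n: "0 < n" "a [^] n \<in> H" "\<And>m::nat. a [^] m \<in> H \<Longrightarrow> n dvd m"
    using least_power_in_subgroup[OF H a] by blast
  have "n dvd group_exponent G" using n(3) pow_exponent[OF a] H by (simp add: subgroup.one_closed)
  then obtain m where m: "group_exponent G = n * m" by blast
  have "\<phi> (a [^] n) ^ m = \<phi> ((a [^] n) [^] m)" using mult_on_pow[OF H \<phi> n(2)] by simp
  also have "(a [^] n) [^] m = \<one>" using a pow_exponent[OF a] m by (simp add: nat_pow_pow)
  finally have "\<phi> (a [^] n) ^ m = 1" using \<phi> by (simp add: mult_on_def)
  then obtain k where k: "\<phi> (a [^] n) = (\<zeta> ^ n) ^ k"
    using root_of_unity_is_power primitive_root_of_unity_power primitive m by metis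
  then have "(\<zeta> ^ k) ^ n = \<phi> (a [^] n)" by (simp add: mult.commute flip: power_mult)
  from mult_on_extend_by_root[OF H \<phi> a n(2,3) this] show ?thesis by blast
qed

text \<open>An extension of \<open>\<phi>\<close> to a subgroup of largest size is defined on all of
  \<open>G\<close>, since the one-step extension would otherwise enlarge it.\<close>

lemma mult_on_extend:
  assumes H: "subgroup H G" and \<phi>: "mult_on H \<phi>"
  shows "\<exists>\<chi>\<in>carrier Ghat. \<forall>h\<in>H. \<chi> h = \<phi> h"
proof -
  let ?\<F> = "{B. subgroup B G \<and> H \<subseteq> B \<and> (\<exists>\<psi>. mult_on B \<psi> \<and> (\<forall>h\<in>H. \<psi> h = \<phi> h))}"
  let ?m = "Max (card ` ?\<F>)"
  have fin: "finite ?\<F>"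
    by (rule finite_subset[of _ "Pow (carrier G)"]) (auto simp: finite_G dest: subgroup.subset)
  moreover have "H \<in> ?\<F>" using H \<phi> by auto
  ultimately have "?m \<in> card ` ?\<F>" by (intro Max_in) auto
  then obtain B \<psi> where B: "subgroup B G" "H \<subseteq> B" "mult_on B \<psi>" "\<And>h. h \<in> H \<Longrightarrow> \<psi> h = \<phi> h"
    "card B = ?m" by auto
  have "a \<in> B" if a: "a \<in> carrier G" for a
  proof (rule ccontr)
    assume "a \<notin> B"
    obtain C \<theta> where C: "subgroup C G" "B \<subseteq> C" "a \<in> C" "mult_on C \<theta>" "\<forall>h\<in>B. \<theta> h = \<psi> h"
      using mult_on_extend_step[OF B(1,3) a] by blast
    have "C \<in> ?\<F>" using B(2,4) C by (auto intro!: exI[of _ \<theta>])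
    then have "card C \<le> ?m" using fin by (intro Max_ge) auto
    moreover have "card B < card C"
      using C \<open>a \<notin> B\<close> finite_subset[OF subgroup.subset finite_G] by (intro psubset_card_mono) auto
    ultimately show False using B by simp
  qed
  then have BG: "B = carrier G" using subgroup.subset[OF B(1)] by blast
  have nz: "\<psi> x \<noteq> 0" if "x \<in> carrier G" for x
  proof -
    have "\<psi> x * \<psi> (inv x) = \<psi> (x \<otimes> inv x)" using B(3) that BG inv_closed unfolding mult_on_def by metis
    also have "\<dots> = 1" using B(3) that by (simp add: mult_on_def)
    finally show ?thesis by auto
  qed
  have "restrict \<psi> (carrier G) \<in> carrier Ghat"
    using B(3) nz by (auto simp: mem_char_group_iff mult_on_def BG)
  moreover have "\<forall>h\<in>H. restrict \<psi> (carrier G) h = \<phi> h"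
    using B(4) subgroup.subset[OF H] by auto
  ultimately show ?thesis by blast
qed

text \<open>The trivial character of \<open>{\<one>}\<close> extends with value at \<open>a\<close>
  a primitive root of unity of order \<open>n\<close>, the order of \<open>a\<close>. This value is
  not 1, and a second extension reaches all of \<open>G\<close>.\<close>

lemma characters_separate:
  assumes a: "a \<in> carrier G" "a \<noteq> \<one>"
  shows "\<exists>\<chi>\<in>carrier Ghat. \<chi> a \<noteq> 1"
proof -
  have 1: "subgroup {\<one>} G" by (rule triv_subgroup)
  have \<phi>: "mult_on {\<one>} (\<lambda>_. 1)" by (simp add: mult_on_def)
  obtain n :: nat where n: "0 < n" "a [^] n \<in> {\<one>}" "\<And>m::nat. a [^] m \<in> {\<one>} \<Longrightarrow> n dvd m"
    using least_power_in_subgroup[OF 1 a(1)] by blast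
  have "n dvd group_exponent G" using n(3) pow_exponent[OF a(1)] by simp
  then obtain m where m: "group_exponent G = m * n" by (metis dvdE mult.commute)
  then have prim: "primitive_root_of_unity n (\<zeta> ^ m)"
    using primitive_root_of_unity_power primitive by metis
  have "n \<noteq> 1" using n(2) a by auto
  then have y: "(\<zeta> ^ m) ^ n = 1" "\<zeta> ^ m \<noteq> 1"
    using prim n(1) by (auto simp: primitive_root_of_unity_def dest: spec[of _ 1])
  obtain H \<psi> where H: "subgroup H G" "a \<in> H" "mult_on H \<psi>" "\<psi> a = \<zeta> ^ m"
    using mult_on_extend_by_root[OF 1 \<phi> a(1) n(2,3) y(1)] by blast
  then show ?thesis using mult_on_extend[OF H(1,3)] y by metis
qed

section \<open>Orthogonality and Fourier inversion\<close>

lemma char_mult: "\<lbrakk>\<chi> \<in> carrier Ghat; x \<in> carrier G; y \<in> carrier G\<rbrakk> \<Longrightarrow> \<chi> (x \<otimes> y) = \<chi> x * \<chi> y"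
  and char_nonzero: "\<lbrakk>\<chi> \<in> carrier Ghat; x \<in> carrier G\<rbrakk> \<Longrightarrow> \<chi> x \<noteq> 0"
  by (auto simp: mem_char_group_iff)

lemma char_one: "\<chi> \<in> carrier Ghat \<Longrightarrow> \<chi> \<one> = 1"
  using char_mult[of \<chi> \<one> \<one>] char_nonzero[of \<chi> \<one>] by simp

lemma char_inv: "\<lbrakk>\<chi> \<in> carrier Ghat; x \<in> carrier G\<rbrakk> \<Longrightarrow> \<chi> (inv x) = inverse (\<chi> x)"
  using char_mult[of \<chi> x "inv x"] char_nonzero[of \<chi> x] char_one[of \<chi>]
  by (simp add: inverse_unique)

lemma char_pow: "\<lbrakk>\<chi> \<in> carrier Ghat; x \<in> carrier G\<rbrakk> \<Longrightarrow> \<chi> (x [^] (n::nat)) = \<chi> x ^ n"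
  by (induction n) (simp_all add: char_one char_mult)

lemma char_eqI:
  "\<lbrakk>\<chi> \<in> carrier Ghat; \<psi> \<in> carrier Ghat; \<And>x. x \<in> carrier G \<Longrightarrow> \<chi> x = \<psi> x\<rbrakk> \<Longrightarrow> \<chi> = \<psi>"
  by (auto simp: mem_char_group_iff intro: extensionalityI)

sublocale Ghat: comm_group Ghat
  by (rule comm_group_char_group) (rule is_group)

lemma Ghat_mult_apply: "x \<in> carrier G \<Longrightarrow> (\<chi> \<otimes>\<^bsub>Ghat\<^esub> \<psi>) x = \<chi> x * \<psi> x"
  by (simp add: char_group_def)

lemma Ghat_one_apply: "x \<in> carrier G \<Longrightarrow> \<one>\<^bsub>Ghat\<^esub> x = 1"
  by (simp add: char_group_def)

lemma Ghat_inv_apply: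
  assumes "\<chi> \<in> carrier Ghat" "x \<in> carrier G"
  shows "(inv\<^bsub>Ghat\<^esub> \<chi>) x = inverse (\<chi> x)"
proof -
  have "\<chi> x * (inv\<^bsub>Ghat\<^esub> \<chi>) x = (\<chi> \<otimes>\<^bsub>Ghat\<^esub> inv\<^bsub>Ghat\<^esub> \<chi>) x"
    using assms(2) by (rule Ghat_mult_apply[symmetric])
  also have "\<dots> = 1" using assms by (simp add: Ghat_one_apply)
  finally show ?thesis by (simp add: inverse_unique)
qed

text \<open>Values of characters are roots of unity for the exponent, so characters are extensional
  functions between finite sets.\<close>

lemma finite_Ghat: "finite (carrier Ghat)"
proof -
  let ?R = "{z :: 'e. z ^ group_exponent G = 1}"
  have "finite ?R"
    using primitive by (intro finite_card_roots_of_unity) (simp add: primitive_root_of_unity_def)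
  moreover have "carrier Ghat \<subseteq> carrier G \<rightarrow>\<^sub>E ?R"
  proof
    fix \<chi> assume \<chi>: "\<chi> \<in> carrier Ghat"
    then have "\<chi> x ^ group_exponent G = 1" if "x \<in> carrier G" for x
      using that by (simp add: char_one pow_exponent flip: char_pow)
    then show "\<chi> \<in> carrier G \<rightarrow>\<^sub>E ?R" using \<chi> by (auto simp: PiE_def mem_char_group_iff)
  qed
  ultimately show ?thesis using finite_PiE[OF finite_G] finite_subset by metis
qed

text \<open>Substituting \<open>h \<otimes> x\<close> for \<open>x\<close> multiplies the sum by
  \<open>\<chi> h\<close>, which is not 1.\<close>

lemma sum_char_subgroup:
  assumes H: "subgroup H G" and \<chi>: "\<chi> \<in> carrier Ghat" and h: "h \<in> H" "\<chi> h \<noteq> 1"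
  shows "(\<Sum>x\<in>H. \<chi> x) = 0"
proof -
  interpret H: subgroup H G by fact
  have "(\<Sum>x\<in>H. \<chi> x) = (\<Sum>x\<in>H. \<chi> (h \<otimes> x))"
    by (rule sum.reindex_bij_witness[of _ "\<lambda>x. h \<otimes> x" "\<lambda>x. inv h \<otimes> x"])
       (use h in \<open>auto simp: m_assoc[symmetric]\<close>)
  also have "\<dots> = \<chi> h * (\<Sum>x\<in>H. \<chi> x)"
    using h \<chi> by (simp add: char_mult sum_distrib_left)
  finally have "(1 - \<chi> h) * (\<Sum>x\<in>H. \<chi> x) = 0" by (simp add: algebra_simps)
  then show ?thesis using h by simp
qed

text \<open>The summand is the quotient of the two characters, itself a character, and nontrivial
  when they differ.\<close>

lemma sum_char_ratio:
  assumes \<chi>: "\<chi> \<in> carrier Ghat" and \<psi>: "\<psi> \<in> carrier Ghat"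
  shows "(\<Sum>x\<in>carrier G. \<chi> x * \<psi> (inv x)) = (if \<chi> = \<psi> then of_nat (card (carrier G)) else 0)"
proof (cases "\<chi> = \<psi>")
  case True
  then show ?thesis using \<psi> by (simp add: char_inv char_nonzero)
next
  case False
  then obtain y where y: "y \<in> carrier G" "\<chi> y \<noteq> \<psi> y" using char_eqI \<chi> \<psi> by blast
  let ?\<theta> = "\<lambda>x\<in>carrier G. \<chi> x * \<psi> (inv x)"
  have "?\<theta> \<in> carrier Ghat"
    using \<chi> \<psi> by (simp add: mem_char_group_iff inv_mult)
  moreover have "?\<theta> y \<noteq> 1"
    using y \<psi> by (simp add: char_inv char_nonzero flip: divide_inverse)
  ultimately have "(\<Sum>x\<in>carrier G. ?\<theta> x) = 0"
    using sum_char_subgroup[OF subgroup_self _ y(1)] by blast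
  then show ?thesis using False by simp
qed

text \<open>Dual orthogonality: multiplication by a character \<open>\<psi>\<close> with
  \<open>\<psi> x \<noteq> 1\<close> permutes the characters and scales the sum by
  \<open>\<psi> x\<close>.\<close>

lemma sum_over_characters:
  assumes x: "x \<in> carrier G"
  shows "(\<Sum>\<chi>\<in>carrier Ghat. \<chi> x) = (if x = \<one> then of_nat (card (carrier Ghat)) else 0)"
proof (cases "x = \<one>")
  case True
  then show ?thesis by (simp add: char_one)
next
  case False
  then obtain \<psi> where \<psi>: "\<psi> \<in> carrier Ghat" "\<psi> x \<noteq> 1" using characters_separate x by blast
  have "(\<Sum>\<chi>\<in>carrier Ghat. \<chi> x) = (\<Sum>\<chi>\<in>carrier Ghat. (\<psi> \<otimes>\<^bsub>Ghat\<^esub> \<chi>) x)"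
    by (rule sum.reindex_bij_witness[of _ "\<lambda>\<chi>. \<psi> \<otimes>\<^bsub>Ghat\<^esub> \<chi>" "\<lambda>\<chi>. inv\<^bsub>Ghat\<^esub> \<psi> \<otimes>\<^bsub>Ghat\<^esub> \<chi>"])
       (use \<psi> in \<open>auto simp: Ghat.m_assoc[symmetric]\<close>)
  also have "\<dots> = \<psi> x * (\<Sum>\<chi>\<in>carrier Ghat. \<chi> x)"
    using x by (simp add: Ghat_mult_apply sum_distrib_left)
  finally have "(1 - \<psi> x) * (\<Sum>\<chi>\<in>carrier Ghat. \<chi> x) = 0" by (simp add: algebra_simps)
  then show ?thesis using \<psi> False by simp
qed

text \<open>All values \<open>\<chi> x\<close> are summed in both orders: only the trivial character
  survives in one, only \<open>\<one>\<close> in the other.\<close>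

lemma of_nat_card_Ghat: "(of_nat (card (carrier Ghat)) :: 'e) = of_nat (card (carrier G))"
proof -
  have "(\<Sum>\<chi>\<in>carrier Ghat. \<Sum>x\<in>carrier G. \<chi> x)
      = (\<Sum>\<chi>\<in>carrier Ghat. if \<chi> = \<one>\<^bsub>Ghat\<^esub> then of_nat (card (carrier G)) else 0)"
  proof (rule sum.cong[OF refl])
    fix \<chi> assume "\<chi> \<in> carrier Ghat"
    from sum_char_ratio[OF this Ghat.one_closed]
    show "(\<Sum>x\<in>carrier G. \<chi> x) = (if \<chi> = \<one>\<^bsub>Ghat\<^esub> then of_nat (card (carrier G)) else 0)"
      by (simp add: Ghat_one_apply)
  qed
  also have "\<dots> = of_nat (card (carrier G))"
    using finite_Ghat by simp
  finally have "of_nat (card (carrier G)) = (\<Sum>\<chi>\<in>carrier Ghat. \<Sum>x\<in>carrier G. \<chi> x)" ..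
  also have "\<dots> = (\<Sum>x\<in>carrier G. if x = \<one> then of_nat (card (carrier Ghat)) else 0)"
    by (subst sum.swap) (simp add: sum_over_characters)
  also have "\<dots> = of_nat (card (carrier Ghat))" using finite_G by simp
  finally show ?thesis by simp
qed

text \<open>After the sums are interchanged, dual orthogonality leaves the term
  \<open>y = x\<close>, with the number of characters as its factor.\<close>

lemma fourier_inversion:
  assumes x: "x \<in> carrier G"
  shows "(\<Sum>\<chi>\<in>carrier Ghat. fourier G f \<chi> * \<chi> x) = of_nat (card (carrier G)) * f x"
proof -
  have "(\<Sum>\<chi>\<in>carrier Ghat. fourier G f \<chi> * \<chi> x)
      = (\<Sum>\<chi>\<in>carrier Ghat. \<Sum>y\<in>carrier G. f y * \<chi> (inv y \<otimes> x))"
    using x by (simp add: fourier_def sum_distrib_right char_mult mult.assoc)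
  also have "\<dots> = (\<Sum>y\<in>carrier G. f y * (\<Sum>\<chi>\<in>carrier Ghat. \<chi> (inv y \<otimes> x)))"
    by (subst sum.swap) (simp add: sum_distrib_left)
  also have "\<dots> = (\<Sum>y\<in>carrier G. if y = x then of_nat (card (carrier G)) * f x else 0)"
  proof (rule sum.cong[OF refl])
    fix y assume y: "y \<in> carrier G"
    have "inv y \<otimes> x = \<one> \<longleftrightarrow> y = x" using x y inv_equality l_inv inv_inv by (metis inv_closed)
    then show "f y * (\<Sum>\<chi>\<in>carrier Ghat. \<chi> (inv y \<otimes> x))
        = (if y = x then of_nat (card (carrier G)) * f x else 0)"
      using x y by (simp add: sum_over_characters of_nat_card_Ghat)
  qed
  also have "\<dots> = of_nat (card (carrier G)) * f x" using finite_G x by simp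
  finally show ?thesis .
qed

lemma fourier_nonzero:
  assumes "x \<in> carrier G" "f x \<noteq> 0"
  shows "\<exists>\<chi>\<in>carrier Ghat. fourier G f \<chi> \<noteq> 0"
proof (rule ccontr)
  assume "\<not> ?thesis"
  then have "(\<Sum>\<chi>\<in>carrier Ghat. fourier G f \<chi> * \<chi> x) = 0" by simp
  then show False using fourier_inversion[OF assms(1), of f] assms(2) card_nonzero by simp
qed

text \<open>Pairing the relation with \<open>\<psi>\<close> isolates \<open>c \<psi>\<close> times
  the order of \<open>G\<close>, which is nonzero in the field.\<close>

lemma characters_independent:
  assumes A: "A \<subseteq> carrier Ghat" and c: "\<And>x. x \<in> carrier G \<Longrightarrow> (\<Sum>\<chi>\<in>A. c \<chi> * \<chi> x) = 0"
    and \<psi>: "\<psi> \<in> A"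
  shows "c \<psi> = 0"
proof -
  have fin: "finite A" using A finite_Ghat finite_subset by blast
  have "0 = (\<Sum>x\<in>carrier G. (\<Sum>\<chi>\<in>A. c \<chi> * \<chi> x) * \<psi> (inv x))" by (simp add: c)
  also have "\<dots> = (\<Sum>\<chi>\<in>A. c \<chi> * (\<Sum>x\<in>carrier G. \<chi> x * \<psi> (inv x)))"
    unfolding sum_distrib_right sum_distrib_left by (subst sum.swap) (simp add: mult.assoc)
  also have "\<dots> = (\<Sum>\<chi>\<in>A. if \<chi> = \<psi> then c \<psi> * of_nat (card (carrier G)) else 0)"
    using A \<psi> by (intro sum.cong[OF refl]) (auto simp: sum_char_ratio subset_iff)
  also have "\<dots> = c \<psi> * of_nat (card (carrier G))" using fin \<psi> by simp
  finally show ?thesis using card_nonzero by simp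
qed

section \<open>Annihilators and the number of characters\<close>

definition annihilator :: "'g set \<Rightarrow> ('g \<Rightarrow> 'e) set" where
  "annihilator H = {\<chi> \<in> carrier Ghat. \<forall>h\<in>H. \<chi> h = 1}"

text \<open>Characters trivial on \<open>H\<close> are constant on its cosets, so they are
  independent functions on a set of \<open>card (rcosets H)\<close> points.\<close>

lemma card_annihilator_le:
  assumes H: "subgroup H G"
  shows "card (annihilator H) * card H \<le> card (carrier G)"
proof -
  have fin: "finite (rcosets H)" using finite_G by (simp add: RCOSETS_def)
  have "card (annihilator H) \<le> card (rcosets H)"
  proof (rule ccontr)
    assume "\<not> ?thesis"
    moreover have "finite (annihilator H)" using finite_Ghat by (auto simp: annihilator_def)
    ultimately obtain c where c: "\<exists>\<chi>\<in>annihilator H. c \<chi> \<noteq> 0"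
      "\<And>C. C \<in> rcosets H \<Longrightarrow> (\<Sum>\<chi>\<in>annihilator H. c \<chi> * \<chi> (SOME x. x \<in> C)) = 0"
      using underdetermined_system_has_nontrivial_solution
        [OF fin, of "annihilator H" "\<lambda>\<chi> C. \<chi> (SOME x. x \<in> C)"] by auto
    \<comment> \<open>Each such character has the same value at \<open>x\<close> as at the chosen
      representative of its coset, so a relation at the representatives holds everywhere.\<close>
    have "(\<Sum>\<chi>\<in>annihilator H. c \<chi> * \<chi> x) = 0" if x: "x \<in> carrier G" for x
    proof -
      have "x \<in> H #> x" using H x by (rule rcos_self[rotated])
      then have "(SOME y. y \<in> H #> x) \<in> H #> x" by (rule someI)
      then obtain h where h: "h \<in> H" "(SOME y. y \<in> H #> x) = h \<otimes> x" by (auto simp: r_coset_def)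
      have "\<chi> (SOME y. y \<in> H #> x) = \<chi> x" if "\<chi> \<in> annihilator H" for \<chi>
        using that h x subgroup.mem_carrier[OF H h(1)] by (simp add: annihilator_def char_mult)
      then have "(\<Sum>\<chi>\<in>annihilator H. c \<chi> * \<chi> x)
          = (\<Sum>\<chi>\<in>annihilator H. c \<chi> * \<chi> (SOME y. y \<in> H #> x))"
        by (intro sum.cong[OF refl]) metis
      also have "\<dots> = 0" using x subgroup.subset[OF H] by (intro c(2)) (rule rcosetsI)
      finally show ?thesis .
    qed
    then show False using characters_independent[of "annihilator H" c] c(1)
      by (auto simp: annihilator_def)
  qed
  then have "card (annihilator H) * card H \<le> card (rcosets H) * card H" by simp
  also have "\<dots> = card (carrier G)" using lagrange[OF H] by (simp add: Coset.order_def)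
  finally show ?thesis .
qed

text \<open>
  The identity \<open>of_nat_card_Ghat\<close> determines the number of characters only modulo the
  characteristic, so both inequalities are obtained by counting dimensions.
\<close>

lemma card_Ghat: "card (carrier Ghat) = card (carrier G)"
proof (rule antisym)
  have "annihilator {\<one>} = carrier Ghat" by (auto simp: annihilator_def char_one)
  then show "card (carrier Ghat) \<le> card (carrier G)"
    using card_annihilator_le[OF triv_subgroup] by simp
next
  \<comment> \<open>With fewer characters than group elements, some function \<open>c\<close> that
    is not zero on \<open>G\<close> would have a vanishing transform.\<close>
  show "card (carrier G) \<le> card (carrier Ghat)"
  proof (rule ccontr)
    assume "\<not> ?thesis"
    then obtain c where c: "\<exists>x\<in>carrier G. c x \<noteq> 0"
      "\<And>\<chi>. \<chi> \<in> carrier Ghat \<Longrightarrow> (\<Sum>x\<in>carrier G. c x * \<chi> (inv x)) = 0"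
      using underdetermined_system_has_nontrivial_solution
        [OF finite_Ghat finite_G, of "\<lambda>x \<chi>. \<chi> (inv x)"] by auto
    then show False using fourier_nonzero[of _ c] by (auto simp: fourier_def)
  qed
qed

section \<open>The uncertainty principle\<close>

text \<open>Evaluation of characters at a fixed point is multiplicative in the character, and the
  transform combines these evaluations with the values of \<open>f\<close> as coefficients.\<close>

lemma fourier_multiplicative_combination:
  assumes K: "subgroup K Ghat" and nz: "\<exists>\<chi>\<in>K. fourier G f \<chi> \<noteq> 0"
  shows "multiplicative_combination (Ghat\<lparr>carrier := K\<rparr>) (supp_on G f) f (\<lambda>x \<chi>. \<chi> (inv x)) (fourier G f)"
proof -
  have KG: "K \<subseteq> carrier Ghat" using K by (rule subgroup.subset)
  interpret K: comm_group "Ghat\<lparr>carrier := K\<rparr>"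
    using K KG by (intro group.group_comm_groupI Ghat.subgroup_imp_group) (auto intro: Ghat.m_comm)
  show ?thesis
  proof unfold_locales
    show "finite (carrier (Ghat\<lparr>carrier := K\<rparr>))" using KG finite_Ghat finite_subset by auto
    show "finite (supp_on G f)" using finite_G by (simp add: supp_on_def)
    show "\<exists>x\<in>carrier (Ghat\<lparr>carrier := K\<rparr>). fourier G f x \<noteq> 0" using nz by simp
    show "fourier G f \<chi> = (\<Sum>s\<in>supp_on G f. f s * \<chi> (inv s))" for \<chi>
      unfolding fourier_def using finite_G
      by (intro sum.mono_neutral_right) (auto simp: supp_on_def)
  qed (auto simp: Ghat_mult_apply supp_on_def)
qed

lemma uncertainty_on_subgroup:
  assumes K: "subgroup K Ghat" and nz: "\<exists>\<chi>\<in>K. fourier G f \<chi> \<noteq> 0"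
  shows "card K \<le> card (supp_on G f) * card (supp_on Ghat (fourier G f) \<inter> K)"
    and "card (supp_on G f) * card (supp_on Ghat (fourier G f) \<inter> K) = card K \<Longrightarrow>
      \<exists>L \<chi>. subgroup L (Ghat\<lparr>carrier := K\<rparr>) \<and> \<chi> \<in> K \<and> supp_on Ghat (fourier G f) \<inter> K = \<chi> <#\<^bsub>Ghat\<^esub> L"
proof -
  interpret K: multiplicative_combination "Ghat\<lparr>carrier := K\<rparr>" "supp_on G f" f "\<lambda>x \<chi>. \<chi> (inv x)" "fourier G f"
    using assms by (rule fourier_multiplicative_combination)
  show "card K \<le> card (supp_on G f) * card (supp_on Ghat (fourier G f) \<inter> K)"
    using K.card_carrier_le by (simp add: supp_on_subgroup[OF K])
  assume eq: "card (supp_on G f) * card (supp_on Ghat (fourier G f) \<inter> K) = card K"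
  obtain \<chi> where \<chi>: "\<chi> \<in> K" "fourier G f \<chi> \<noteq> 0" using nz by blast
  have "supp_on (Ghat\<lparr>carrier := K\<rparr>) (fourier G f) = \<chi> <#\<^bsub>Ghat\<lparr>carrier := K\<rparr>\<^esub> K.multiplier_group"
  proof (rule K.supp_eq_coset)
    show "card (supp_on G f) * card (supp_on (Ghat\<lparr>carrier := K\<rparr>) (fourier G f)) = card (carrier (Ghat\<lparr>carrier := K\<rparr>))"
      using eq by (simp add: supp_on_subgroup[OF K])
    show "\<chi> \<in> supp_on (Ghat\<lparr>carrier := K\<rparr>) (fourier G f)" using \<chi> by (simp add: supp_on_def)
  qed
  then have "supp_on Ghat (fourier G f) \<inter> K = \<chi> <#\<^bsub>Ghat\<^esub> K.multiplier_group"
    by (simp add: supp_on_subgroup[OF K] l_coset_def)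
  then show "\<exists>L \<chi>. subgroup L (Ghat\<lparr>carrier := K\<rparr>) \<and> \<chi> \<in> K \<and>
      supp_on Ghat (fourier G f) \<inter> K = \<chi> <#\<^bsub>Ghat\<^esub> L"
    using K.subgroup_multiplier_group \<chi> by blast
qed

text \<open>The case where the subgroup is the whole character group; inversion provides a nonzero
  coefficient.\<close>

lemma uncertainty:
  assumes "\<exists>x\<in>carrier G. f x \<noteq> 0"
  shows "card (carrier G) \<le> card (supp_on G f) * card (supp_on Ghat (fourier G f))"
proof -
  have "supp_on Ghat (fourier G f) \<inter> carrier Ghat = supp_on Ghat (fourier G f)"
    by (auto simp: supp_on_def)
  then show ?thesis
    using uncertainty_on_subgroup(1)[OF Ghat.subgroup_self, of f] fourier_nonzero assms
    by (auto simp: card_Ghat)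
qed

lemma uncertainty_eq_imp_modulated_indicator:
  assumes nz: "\<exists>x\<in>carrier G. f x \<noteq> 0"
    and eq: "card (supp_on G f) * card (supp_on Ghat (fourier G f)) = card (carrier G)"
  shows "\<exists>c \<chi> a H. c \<noteq> 0 \<and> \<chi> \<in> carrier Ghat \<and> a \<in> carrier G \<and> subgroup H G \<and>
    (\<forall>x\<in>carrier G. f x = c * \<chi> x * indicator (a <# H) x)"
proof -
  interpret f: multiplicative_combination G "supp_on Ghat (fourier G f)"
    "\<lambda>\<chi>. fourier G f \<chi> / of_nat (card (carrier G))" "\<lambda>\<chi>. \<chi>" f
  proof unfold_locales
    fix x assume x: "x \<in> carrier G"
    have "f x = (\<Sum>\<chi>\<in>carrier Ghat. fourier G f \<chi> * \<chi> x) / of_nat (card (carrier G))"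
      using fourier_inversion[OF x, of f] card_nonzero by simp
    also have "(\<Sum>\<chi>\<in>carrier Ghat. fourier G f \<chi> * \<chi> x) = (\<Sum>\<chi>\<in>supp_on Ghat (fourier G f). fourier G f \<chi> * \<chi> x)"
      using finite_Ghat by (intro sum.mono_neutral_right) (auto simp: supp_on_def)
    finally show "f x = (\<Sum>\<chi>\<in>supp_on Ghat (fourier G f). fourier G f \<chi> / of_nat (card (carrier G)) * \<chi> x)"
      by (simp add: sum_divide_distrib)
  qed (use nz finite_G finite_Ghat in \<open>auto simp: supp_on_def char_mult\<close>)
  let ?H = "f.multiplier_group"
  have H: "subgroup ?H G" by (rule f.subgroup_multiplier_group)
  obtain a where a: "a \<in> carrier G" "f a \<noteq> 0" using nz by blast
  have supp: "supp_on G f = a <# ?H"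
    by (rule f.supp_eq_coset) (use eq a in \<open>auto simp: supp_on_def mult.commute\<close>)
  \<comment> \<open>Any character with a nonzero coefficient serves as the modulation.\<close>
  obtain \<chi> where \<chi>: "\<chi> \<in> carrier Ghat" "fourier G f \<chi> \<noteq> 0" using fourier_nonzero a by blast
  have transl: "f (h \<otimes> z) = \<chi> h * f z" if h: "h \<in> ?H" and z: "z \<in> carrier G" for h z
  proof -
    obtain \<mu> where hG: "h \<in> carrier G" and \<mu>: "\<And>z. z \<in> carrier G \<Longrightarrow> f (h \<otimes> z) = \<mu> * f z"
      using h by (auto simp: f.multiplier_group_def)
    \<comment> \<open>Replacing \<open>x\<close> by \<open>h \<otimes> x\<close> multiplies this
      coefficient by \<open>\<mu> * inverse (\<chi> h)\<close>; as the coefficient is nonzero, the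
      factor is 1.\<close>
    have "fourier G f \<chi> = (\<Sum>x\<in>carrier G. f (h \<otimes> x) * \<chi> (inv (h \<otimes> x)))"
      unfolding fourier_def
      by (rule sum.reindex_bij_witness[of _ "\<lambda>x. h \<otimes> x" "\<lambda>x. inv h \<otimes> x"])
         (use hG in \<open>auto simp: m_assoc[symmetric]\<close>)
    also have "\<dots> = \<mu> * inverse (\<chi> h) * fourier G f \<chi>"
      unfolding fourier_def sum_distrib_left
      by (rule sum.cong) (use hG \<chi> in \<open>auto simp: \<mu> inv_mult char_mult char_inv\<close>)
    finally have "\<mu> * inverse (\<chi> h) = 1" using \<chi> by simp
    then have "\<mu> = \<chi> h" using char_nonzero[OF \<chi>(1) hG] by (simp add: field_simps)
    then show ?thesis using \<mu> z by simp
  qed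
  \<comment> \<open>The constant is dictated by the value at \<open>a\<close>.\<close>
  let ?c = "f a * inverse (\<chi> a)"
  have "f x = ?c * \<chi> x * indicator (a <# ?H) x" if x: "x \<in> carrier G" for x
  proof (cases "x \<in> a <# ?H")
    case True
    then obtain h where h: "h \<in> ?H" "x = a \<otimes> h" by (auto simp: l_coset_def)
    have hG: "h \<in> carrier G" using h H subgroup.mem_carrier by metis
    have "f x = \<chi> h * f a" using transl[OF h(1) a(1)] h a hG by (simp add: m_comm)
    then show ?thesis using True h hG a \<chi> by (simp add: char_mult char_nonzero)
  next
    case False
    then show ?thesis using supp x by (auto simp: supp_on_def)
  qed
  moreover have "?c \<noteq> 0" using a \<chi> char_nonzero by simp
  ultimately show ?thesis using \<chi> a H by blast
qed

text \<open>The support of \<open>f\<close> has the size of \<open>H\<close>, and that of its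
  transform lies in a translate of \<open>annihilator H\<close>, so the product is at most the order
  of \<open>G\<close>. The uncertainty principle gives the converse inequality.\<close>

lemma modulated_indicator_imp_uncertainty_eq:
  assumes c: "c \<noteq> 0" and \<chi>: "\<chi> \<in> carrier Ghat" and a: "a \<in> carrier G" and H: "subgroup H G"
    and f: "\<And>x. x \<in> carrier G \<Longrightarrow> f x = c * \<chi> x * indicator (a <# H) x"
  shows "card (supp_on G f) * card (supp_on Ghat (fourier G f)) = card (carrier G)"
proof (rule antisym)
  interpret H: subgroup H G by fact
  have aH: "a <# H \<subseteq> carrier G" using a by (auto simp: l_coset_def)
  have supp: "supp_on G f = a <# H"
    using aH c \<chi> by (auto simp: supp_on_def f indicator_def char_nonzero)
  have inj: "inj_on (\<lambda>h. a \<otimes> h) H" using a by (auto simp: inj_on_def)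
  have aH_image: "a <# H = (\<lambda>h. a \<otimes> h) ` H" by (auto simp: l_coset_def)
  have card_supp: "card (supp_on G f) = card H"
    using inj by (simp add: supp aH_image card_image)
  have "\<psi> \<otimes>\<^bsub>Ghat\<^esub> inv\<^bsub>Ghat\<^esub> \<chi> \<in> annihilator H" if "\<psi> \<in> supp_on Ghat (fourier G f)" for \<psi>
  proof -
    have \<psi>: "\<psi> \<in> carrier Ghat" "fourier G f \<psi> \<noteq> 0" using that by (auto simp: supp_on_def)
    let ?\<theta> = "\<chi> \<otimes>\<^bsub>Ghat\<^esub> inv\<^bsub>Ghat\<^esub> \<psi>"
    have \<theta>: "?\<theta> \<in> carrier Ghat" using \<chi> \<psi> by simp
    \<comment> \<open>Up to a constant factor the coefficient is the sum of \<open>?\<theta>\<close>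
      over \<open>H\<close>, so it can be nonzero only if \<open>?\<theta>\<close> is trivial on
      \<open>H\<close>.\<close>
    have "fourier G f \<psi> = (\<Sum>x\<in>a <# H. c * ?\<theta> x)"
      unfolding fourier_def using finite_G aH
      by (intro sum.mono_neutral_cong_right)
         (auto simp: f Ghat_mult_apply Ghat_inv_apply char_inv \<psi> subset_iff)
    also have "\<dots> = (\<Sum>h\<in>H. c * ?\<theta> (a \<otimes> h))"
      using inj by (simp add: aH_image sum.reindex)
    also have "\<dots> = c * ?\<theta> a * (\<Sum>h\<in>H. ?\<theta> h)"
      unfolding sum_distrib_left
      by (intro sum.cong) (auto simp: char_mult[OF \<theta> a] mult.assoc)
    finally have "(\<Sum>h\<in>H. ?\<theta> h) \<noteq> 0" using \<psi> by auto
    then have "?\<theta> h = 1" if "h \<in> H" for h using sum_char_subgroup[OF H \<theta> that] by blast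
    then have "\<chi> h * inverse (\<psi> h) = 1" if "h \<in> H" for h
      using that \<psi> by (metis Ghat_mult_apply Ghat_inv_apply H.mem_carrier)
    then have "\<psi> h * inverse (\<chi> h) = 1" if "h \<in> H" for h
      using that by (metis inverse_1 inverse_inverse_eq inverse_mult_distrib mult.commute)
    then show ?thesis using \<chi> \<psi> by (simp add: annihilator_def Ghat_mult_apply Ghat_inv_apply)
  qed
  then have "card (supp_on Ghat (fourier G f)) \<le> card (annihilator H)"
    using finite_Ghat \<chi>
    by (intro card_inj_on_le[of "\<lambda>\<psi>. \<psi> \<otimes>\<^bsub>Ghat\<^esub> inv\<^bsub>Ghat\<^esub> \<chi>"])
       (auto simp: inj_on_def supp_on_def annihilator_def)
  then have "card (supp_on G f) * card (supp_on Ghat (fourier G f)) \<le> card (annihilator H) * card H"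
    by (simp add: card_supp)
  also have "\<dots> \<le> card (carrier G)" using H by (rule card_annihilator_le)
  finally show "card (supp_on G f) * card (supp_on Ghat (fourier G f)) \<le> card (carrier G)" .
  have "supp_on G f \<noteq> {}" unfolding supp aH_image using H.one_closed by blast
  then show "card (carrier G) \<le> card (supp_on G f) * card (supp_on Ghat (fourier G f))"
    by (intro uncertainty) (auto simp: supp_on_def)
qed

end

text \<open>A nonzero element is invertible, and so is its image. Supports and the nonvanishing of
  the group order thus pass to the larger field.\<close>

lemma ring_hom_field:
  fixes \<iota> :: "'f::field \<Rightarrow> 'e::field"
  assumes \<iota>: "\<iota> \<in> ring_hom ring_of_type_algebra ring_of_type_algebra"
  shows "\<iota> x = 0 \<longleftrightarrow> x = 0" "\<iota> (of_nat n) = of_nat n"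
proof -
  have add: "\<iota> (x + y) = \<iota> x + \<iota> y" and mult: "\<iota> (x * y) = \<iota> x * \<iota> y" and one: "\<iota> 1 = 1" for x y
    using \<iota> by (auto simp: ring_hom_def ring_of_type_algebra_def)
  have zero: "\<iota> 0 = 0" using add[of 0 0] by (metis add_0 add_cancel_right_right)
  show "\<iota> (of_nat n) = of_nat n" by (induction n) (simp_all add: zero add one)
  have "x = 0" if "\<iota> x = 0"
  proof (rule ccontr)
    assume "x \<noteq> 0"
    then have "\<iota> x * \<iota> (inverse x) = 1" by (simp add: one flip: mult)
    then show False using that by simp
  qed
  then show "\<iota> x = 0 \<longleftrightarrow> x = 0" using zero by blast
qed

theorem mainTheorem10:
  fixes G :: "('g, 'm) monoid_scheme"
    and \<iota> :: "'f::field \<Rightarrow> 'e::field"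
  assumes "comm_group G" and "finite (carrier G)"
    and "CHAR('f) = 0 \<or> \<not> CHAR('f) dvd card (carrier G)"
    and "\<iota> \<in> ring_hom ring_of_type_algebra ring_of_type_algebra"
    and "\<exists>\<zeta>::'e. primitive_root_of_unity (group_exponent G) \<zeta>"
  shows
    "(\<forall>(K :: ('g \<Rightarrow> 'e) set) (f :: 'g \<Rightarrow> 'f).
        subgroup K (char_group G) \<longrightarrow> (\<exists>\<chi>\<in>K. fourier G (\<iota> \<circ> f) \<chi> \<noteq> 0) \<longrightarrow>
        card (supp_on G f) * card (supp_on (char_group G) (fourier G (\<iota> \<circ> f)) \<inter> K) \<ge> card K \<and>
        (card (supp_on G f) * card (supp_on (char_group G) (fourier G (\<iota> \<circ> f)) \<inter> K) = card K \<longrightarrow>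
          (\<exists>L \<chi>. subgroup L ((char_group G)\<lparr>carrier := K\<rparr>) \<and> \<chi> \<in> K \<and>
             supp_on (char_group G) (fourier G (\<iota> \<circ> f)) \<inter> K = \<chi> <#\<^bsub>char_group G\<^esub> L))) \<and>
     (\<forall>f :: 'g \<Rightarrow> 'f. (\<exists>x\<in>carrier G. f x \<noteq> 0) \<longrightarrow>
        card (supp_on G f) * card (supp_on (char_group G) (fourier G (\<iota> \<circ> f))) \<ge> card (carrier G) \<and>
        (card (supp_on G f) * card (supp_on (char_group G) (fourier G (\<iota> \<circ> f))) = card (carrier G) \<longleftrightarrow>
          (\<exists>c \<chi> a H. c \<noteq> 0 \<and> \<chi> \<in> carrier (char_group G) \<and> a \<in> carrier G \<and> subgroup H G \<and>
             (\<forall>x\<in>carrier G. \<iota> (f x) = c * \<chi> x * indicator (a <#\<^bsub>G\<^esub> H) x))))"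
proof -
  interpret comm_group G by fact
  obtain \<zeta> :: 'e where \<zeta>: "primitive_root_of_unity (group_exponent G) \<zeta>" using assms(5) by blast
  note \<iota> = ring_hom_field[OF assms(4)]
  \<comment> \<open>In characteristic 0, divisibility by the characteristic means being zero, so
    both alternatives of the assumption make the order nonzero in \<open>'f\<close>.\<close>
  have "card (carrier G) \<noteq> 0" using assms(2) by auto
  then have "of_nat (card (carrier G)) \<noteq> (0 :: 'f)"
    using assms(3) by (auto simp: of_nat_eq_0_iff_char_dvd)
  then have "of_nat (card (carrier G)) \<noteq> (0 :: 'e)" using \<iota> by metis
  then interpret fourier_setting G \<zeta> using assms(2) \<zeta> by unfold_locales
  have supp: "supp_on G f = supp_on G (\<iota> \<circ> f)" for f by (simp add: supp_on_def \<iota>)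
  show ?thesis
  proof (intro conjI allI impI)
    fix K :: "('g \<Rightarrow> 'e) set" and f :: "'g \<Rightarrow> 'f"
    assume "subgroup K Ghat" "\<exists>\<chi>\<in>K. fourier G (\<iota> \<circ> f) \<chi> \<noteq> 0"
    note * = uncertainty_on_subgroup[OF this]
    show "card (supp_on G f) * card (supp_on Ghat (fourier G (\<iota> \<circ> f)) \<inter> K) \<ge> card K"
      unfolding supp by (rule *(1))
    show "\<exists>L \<chi>. subgroup L (Ghat\<lparr>carrier := K\<rparr>) \<and> \<chi> \<in> K \<and>
        supp_on Ghat (fourier G (\<iota> \<circ> f)) \<inter> K = \<chi> <#\<^bsub>Ghat\<^esub> L"
      if "card (supp_on G f) * card (supp_on Ghat (fourier G (\<iota> \<circ> f)) \<inter> K) = card K"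
      using that unfolding supp by (rule *(2))
  next
    fix f :: "'g \<Rightarrow> 'f"
    assume "\<exists>x\<in>carrier G. f x \<noteq> 0"
    then have nz: "\<exists>x\<in>carrier G. (\<iota> \<circ> f) x \<noteq> 0" by (simp add: \<iota>)
    show "card (supp_on G f) * card (supp_on Ghat (fourier G (\<iota> \<circ> f))) \<ge> card (carrier G)"
      unfolding supp by (rule uncertainty[OF nz])
    show "card (supp_on G f) * card (supp_on Ghat (fourier G (\<iota> \<circ> f))) = card (carrier G) \<longleftrightarrow>
        (\<exists>c \<chi> a H. c \<noteq> 0 \<and> \<chi> \<in> carrier Ghat \<and> a \<in> carrier G \<and> subgroup H G \<and>
          (\<forall>x\<in>carrier G. \<iota> (f x) = c * \<chi> x * indicator (a <#\<^bsub>G\<^esub> H) x))"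
      unfolding supp
      using uncertainty_eq_imp_modulated_indicator[OF nz]
        modulated_indicator_imp_uncertainty_eq[of _ _ _ _ "\<iota> \<circ> f"] by (auto simp: comp_def)
  qed
qed

end
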